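(* Let $u=(u_1,u_2,u_3,u_4)$, $u_i\ge0$, be a solution with continuous initial data of the two-dimensional Broadwell system $$\begin{aligned} \partial_t u_1+\mathbf c_1\cdot\nabla u_1&=u_2u_4-u_1u_3, &\quad \partial_t u_3+\mathbf c_3\cdot\nabla u_3&=u_2u_4-u_1u_3,\\ \partial_t u_2+\mathbf c_2\cdot\nabla u_2&=u_1u_3-u_2u_4, &\quad \partial_t u_4+\mathbf c_4\cdot\nabla u_4&=u_1u_3-u_2u_4, \end{aligned}$$ with $\mathbf c_1=(1,1)$, $\mathbf c_2=(1,-1)$, $\mathbf c_3=(-1,-1)$, $\mathbf c_4=(-1,1)$. If $(t^*,x^* )$ is a primary blow-up point, then $$\limsup_{x\to x^*,\ t\to t^*-}\ |u(t,x)|\cdot\frac{t^*-t}{\ln|\ln(t^*-t)|}\ \ge\ \frac14 .$$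
   Context: Here $u_i=u_i(t,x)$, $x\in\mathbb R^2$, are densities of particles moving with speed $\mathbf c_i$; the equations hold along the characteristic lines $\dot x=\mathbf c_i$. A point $(t^*,x^* )$ is a blow-up point if $\limsup_{x\to x^*,\,t\to t^*-}u_i(t,x)=\infty$ for some $i$. With $C=\max_i|\mathbf c_i|=\sqrt2$, it is a primary blow-up point if it is a blow-up point and the backward cone $\{(t,x):\ |x-x^*|<2C(t^*-t)\}$ contains no other blow-up point (so that $u$ is continuous in the part of this cone with $t\ge0$). $|u|$ is the Euclidean norm of $(u_1,\dots,u_4)$. *)

theory Defs
  imports "HOL-Analysis.Analysis"
begin

text \<open>
  Space-time points are pairs \<open>(t, x)\<close>. The densities form a vector in \<open>real ^ 4\<close>, indexed by
  the numerals \<open>1, 2, 3, 4\<close> of the type \<open>4\<close> (where \<open>4 = 0\<close>).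
\<close>

definition velocity :: "4 \<Rightarrow> real ^ 2" where
  "velocity i =
     (if i = 1 then vector [1, 1]
      else if i = 2 then vector [1, -1]
      else if i = 3 then vector [-1, -1]
      else vector [-1, 1])"

definition max_speed :: real where
  "max_speed = Max (range (\<lambda>i. norm (velocity i)))"

lemma max_speed_eq: "max_speed = sqrt 2"
proof -
  have "norm (velocity i) = sqrt 2" for i
    by (auto simp: velocity_def norm_vec_def L2_set_def sum_2)
  then show ?thesis
    by (simp add: max_speed_def)
qed

definition collision :: "real ^ 4 \<Rightarrow> 4 \<Rightarrow> real" where
  "collision v i =
     (if i = 1 \<or> i = 3 then v $ 2 * v $ 4 - v $ 1 * v $ 3
      else v $ 1 * v $ 3 - v $ 2 * v $ 4)"

text \<open>
  A solution may blow up at different times at different places, so it lives on a set \<open>D\<close> of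
  space-time points: relatively open in \<open>{0..} \<times> UNIV\<close>, containing the whole initial plane
  \<open>t = 0\<close>, and containing with each point its backward cone of dependence. Continuity of \<open>u\<close> on
  \<open>D\<close> includes continuity of the initial data. Since \<open>D\<close> is relatively open, the derivative below
  only involves values of \<open>u\<close> on \<open>D\<close>; it is two-sided for \<open>t > 0\<close> and one-sided for \<open>t = 0\<close>.
\<close>

definition broadwell_solution :: "(real \<times> (real ^ 2)) set \<Rightarrow> (real \<times> (real ^ 2) \<Rightarrow> real ^ 4) \<Rightarrow> bool" where
  "broadwell_solution D u \<longleftrightarrow>
     openin (top_of_set ({0..} \<times> UNIV)) D \<and>
     {0} \<times> UNIV \<subseteq> D \<and>
     (\<forall>t x s y. (t, x) \<in> D \<and> 0 \<le> s \<and> s \<le> t \<and> norm (y - x) \<le> max_speed * (t - s)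
        \<longrightarrow> (s, y) \<in> D) \<and>
     continuous_on D u \<and>
     (\<forall>p\<in>D. \<forall>i. 0 \<le> u p $ i) \<and>
     (\<forall>t x i. (t, x) \<in> D \<longrightarrow>
        ((\<lambda>s. u (s, x + (s - t) *\<^sub>R velocity i) $ i)
           has_real_derivative collision (u (t, x)) i) (at t within {0..}))"

text \<open>
  The filter for \<open>x \<rightarrow> x*\<close>, \<open>t \<rightarrow> t*-\<close>, restricted to the set where the solution is defined.
  If \<open>D\<close> has no points with \<open>t < t*\<close> near \<open>(t*, x*)\<close> it is trivial, and \<open>Limsup\<close> along it is
  \<open>-\<infinity>\<close>; in particular there are no blow-up points with \<open>t* \<le> 0\<close>.
\<close>

definition before_point :: "(real \<times> (real ^ 2)) set \<Rightarrow> real \<Rightarrow> real ^ 2 \<Rightarrow> (real \<times> (real ^ 2)) filter" where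
  "before_point D ts xs = at (ts, xs) within {(t, x). (t, x) \<in> D \<and> t < ts}"

definition blowup_point ::
  "(real \<times> (real ^ 2)) set \<Rightarrow> (real \<times> (real ^ 2) \<Rightarrow> real ^ 4) \<Rightarrow> real \<Rightarrow> real ^ 2 \<Rightarrow> bool" where
  "blowup_point D u ts xs \<longleftrightarrow>
     (\<exists>i. Limsup (before_point D ts xs) (\<lambda>p. ereal (u p $ i)) = \<infinity>)"

definition backward_cone :: "real \<Rightarrow> real ^ 2 \<Rightarrow> (real \<times> (real ^ 2)) set" where
  "backward_cone ts xs = {(t, x). norm (x - xs) < 2 * max_speed * (ts - t)}"

text \<open>
  The last conjunct says that the solution exists, hence is continuous, in the part of the cone
  with \<open>t \<ge> 0\<close>. If \<open>D\<close> is the maximal domain of existence, this is a consequence of the absence of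
  blow-up points; it is stated explicitly because \<open>broadwell_solution\<close> does not ask for
  maximality.
\<close>

definition primary_blowup_point ::
  "(real \<times> (real ^ 2)) set \<Rightarrow> (real \<times> (real ^ 2) \<Rightarrow> real ^ 4) \<Rightarrow> real \<Rightarrow> real ^ 2 \<Rightarrow> bool" where
  "primary_blowup_point D u ts xs \<longleftrightarrow>
     blowup_point D u ts xs \<and>
     (\<forall>(t, x) \<in> backward_cone ts xs. \<not> blowup_point D u t x) \<and>
     backward_cone ts xs \<inter> ({0..} \<times> UNIV) \<subseteq> D"

end

theory Submission
  imports Defs
begin

text \<open>
  Suppose that \<open>|u| \<le> ln |ln (t* - t)| / (4 (t* - t))\<close> near the blow-up point. In the plane spanned by
  the space-time directions of two neighbouring species, their total mass is conserved, so the mass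
  \<open>E(\<tau>)\<close> that crosses the two backward characteristics of length \<open>\<tau>\<close> ending at a point equals the mass
  flowing into a square of side \<open>\<tau>\<close>. A particle escapes from the smaller square of side \<open>\<eta>\<close>
  with a probability bounded below by the collision rate: if all densities are at most \<open>B / s\<close> at
  distance \<open>s\<close> in time, then, up to the particles entering near the corners,
  \<open>E(\<tau>) - E(\<eta>) \<ge> exp (- 2 B) E(\<tau>)\<close>. For \<open>\<tau> = exp (- k^2)\<close> and \<open>\<eta> = exp (- (k + 1)^2)\<close> the
  assumed rate gives \<open>exp (- 2 B) = 1 / (k + 1)\<close>, a divergent series, so \<open>E\<close> drops below \<open>1/2\<close> at
  some scale that is uniform near the blow-up point. Since each density grows along its
  characteristic at most by \<open>E\<close> times the supremum of the densities, this bounds \<open>u\<close>.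
\<close>

section \<open>Calculus on a square\<close>

lemma continuous_on_slices:
  fixes f :: "'a::topological_space \<Rightarrow> 'b::topological_space \<Rightarrow> 'c::topological_space"
  assumes "continuous_on (A \<times> B) (\<lambda>(x, y). f x y)"
  shows continuous_on_slice1: "x \<in> A \<Longrightarrow> S \<subseteq> B \<Longrightarrow> continuous_on S (f x)"
    and continuous_on_slice2: "y \<in> B \<Longrightarrow> R \<subseteq> A \<Longrightarrow> continuous_on R (\<lambda>x. f x y)"
proof -
  show "continuous_on S (f x)" if "x \<in> A" "S \<subseteq> B"
    using that continuous_on_compose2[OF assms, where f = "\<lambda>y. (x, y)" and s = S]
    by (auto simp: continuous_on_Pair)
  show "continuous_on R (\<lambda>x. f x y)" if "y \<in> B" "R \<subseteq> A"
    using that continuous_on_compose2[OF assms, where f = "\<lambda>x. (x, y)" and s = R]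
    by (auto simp: continuous_on_Pair)
qed

text \<open>The fundamental theorem of calculus is applied in one variable at a time and the
  integrals are swapped by continuity. Only the \<open>x\<close>-derivative of \<open>A\<close> and
  the \<open>y\<close>-derivative of \<open>C\<close> enter, which is what equations along
  characteristics provide.\<close>

lemma green_square:
  fixes A C f g :: "real \<Rightarrow> real \<Rightarrow> real"
  assumes "a \<le> b"
    and cf: "continuous_on ({a..b} \<times> {a..b}) (\<lambda>(x, y). f x y)"
    and cg: "continuous_on ({a..b} \<times> {a..b}) (\<lambda>(x, y). g x y)"
    and dA: "\<And>x y. x \<in> {a..b} \<Longrightarrow> y \<in> {a..b} \<Longrightarrow>
      ((\<lambda>x. A x y) has_real_derivative f x y) (at x within {a..b})"
    and dC: "\<And>x y. x \<in> {a..b} \<Longrightarrow> y \<in> {a..b} \<Longrightarrow>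
      ((\<lambda>y. C x y) has_real_derivative g x y) (at y within {a..b})"
  shows "integral {a..b} (\<lambda>y. A b y - A a y) + integral {a..b} (\<lambda>x. C x b - C x a) =
    integral {a..b} (\<lambda>x. integral {a..b} (\<lambda>y. f x y + g x y))"
proof -
  have slice: "(\<lambda>y. h x y) integrable_on {a..b}"
    if "continuous_on ({a..b} \<times> {a..b}) (\<lambda>(x, y). h x y)" "x \<in> {a..b}"
    for h :: "real \<Rightarrow> real \<Rightarrow> real" and x
    by (rule integrable_continuous_real, rule continuous_on_slice1[OF that]) simp
  have par: "(\<lambda>x. integral {a..b} (h x)) integrable_on {a..b}"
    if "continuous_on ({a..b} \<times> {a..b}) (\<lambda>(x, y). h x y)"
    for h :: "real \<Rightarrow> real \<Rightarrow> real"
    using integral_continuous_on_param[of "{a..b}" a b h] that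
    by (intro integrable_continuous_real) (simp add: cbox_interval)
  have ftc: "integral {a..b} h' = h b - h a"
    if "\<And>x. x \<in> {a..b} \<Longrightarrow> (h has_real_derivative h' x) (at x within {a..b})" for h h'
    using that \<open>a \<le> b\<close>
    by (intro integral_unique fundamental_theorem_of_calculus)
      (simp_all flip: has_real_derivative_iff_has_vector_derivative)
  have "integral {a..b} (\<lambda>y. A b y - A a y) = integral {a..b} (\<lambda>y. integral {a..b} (\<lambda>x. f x y))"
    by (rule integral_cong, rule ftc[symmetric], rule dA)
  also have "\<dots> = integral {a..b} (\<lambda>x. integral {a..b} (\<lambda>y. f x y))"
    using integral_swap_continuous[of a a b b f, unfolded cbox_Pair_eq, unfolded cbox_interval, OF cf]
    by (rule sym)
  finally have 1: "integral {a..b} (\<lambda>y. A b y - A a y) = \<dots>" .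
  have 2: "integral {a..b} (\<lambda>x. C x b - C x a) = integral {a..b} (\<lambda>x. integral {a..b} (\<lambda>y. g x y))"
    by (rule integral_cong, rule ftc[symmetric], rule dC)
  have 3: "integral {a..b} (\<lambda>x. integral {a..b} (\<lambda>y. f x y + g x y)) =
    integral {a..b} (\<lambda>x. integral {a..b} (f x) + integral {a..b} (g x))"
    by (intro integral_cong Henstock_Kurzweil_Integration.integral_add slice cf cg)
  show ?thesis
    unfolding 1 2 3 by (intro Henstock_Kurzweil_Integration.integral_add[symmetric] par cf cg)
qed

section \<open>Two streams that exchange mass in a characteristic square\<close>

text \<open>
  The coordinates \<open>x\<close> and \<open>y\<close> run backwards along the characteristics of \<open>G\<close> and \<open>H\<close>, so that both
  streams move towards the axes.
\<close>

locale two_stream =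
  fixes T :: real and G H p q :: "real \<Rightarrow> real \<Rightarrow> real"
  assumes contG: "continuous_on ({0..T} \<times> {0..T}) (\<lambda>(x, y). G x y)"
    and contH: "continuous_on ({0..T} \<times> {0..T}) (\<lambda>(x, y). H x y)"
    and contp: "continuous_on ({0..T} \<times> {0..T}) (\<lambda>(x, y). p x y)"
    and contq: "continuous_on ({0..T} \<times> {0..T}) (\<lambda>(x, y). q x y)"
    and nonneg: "\<And>x y. x \<in> {0..T} \<Longrightarrow> y \<in> {0..T} \<Longrightarrow> 0 \<le> G x y \<and> 0 \<le> H x y \<and> 0 \<le> p x y \<and> 0 \<le> q x y"
    and derivG: "\<And>x y. x \<in> {0..T} \<Longrightarrow> y \<in> {0..T} \<Longrightarrow>
      ((\<lambda>x. G x y) has_real_derivative G x y * p x y - H x y * q x y) (at x within {0..T})"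
    and derivH: "\<And>x y. x \<in> {0..T} \<Longrightarrow> y \<in> {0..T} \<Longrightarrow>
      ((\<lambda>y. H x y) has_real_derivative H x y * q x y - G x y * p x y) (at y within {0..T})"
begin

text \<open>The mass \<open>E\<close> of the overview: what leaves the square of side
  \<open>\<tau>\<close> through its two edges on the axes.\<close>

definition outflow :: "real \<Rightarrow> real" where
  "outflow \<tau> = integral {0..\<tau>} (G 0) + integral {0..\<tau>} (\<lambda>x. H x 0)"

text \<open>The symmetry of the two streams: an estimate proved for \<open>G\<close> carries over to
  \<open>H\<close>.\<close>

lemma swap: "two_stream T (\<lambda>x y. H y x) (\<lambda>x y. G y x) (\<lambda>x y. q y x) (\<lambda>x y. p y x)"
proof -
  have *: "continuous_on ({0..T} \<times> {0..T}) (\<lambda>(x, y). h y x)"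
    if "continuous_on ({0..T} \<times> {0..T}) (\<lambda>(x, y). h x y)" for h :: "real \<Rightarrow> real \<Rightarrow> real"
    using continuous_on_compose2[OF that continuous_on_swap, of "{0..T} \<times> {0..T}"]
    by (auto simp: split_beta product_swap)
  show ?thesis
    using nonneg derivG derivH
    by unfold_locales (auto intro!: * contG contH contp contq)
qed

lemma cont_slices:
  assumes "z \<in> {0..T}" "S \<subseteq> {0..T}"
  shows "continuous_on S (G z)" "continuous_on S (\<lambda>x. H x z)"
  using assms by (auto intro: continuous_on_slices[OF contG] continuous_on_slices[OF contH])

lemma integrable_slices:
  assumes "z \<in> {0..T}" "0 \<le> a" "b \<le> T"
  shows "G z integrable_on {a..b}" "(\<lambda>x. H x z) integrable_on {a..b}"
  using assms by (auto intro!: integrable_continuous_real cont_slices)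

text \<open>Conservation of mass: in Green's identity the two collision terms cancel.\<close>

lemma outflow_eq_inflow:
  assumes "0 \<le> \<tau>" "\<tau> \<le> T"
  shows "outflow \<tau> = integral {0..\<tau>} (G \<tau>) + integral {0..\<tau>} (\<lambda>x. H x \<tau>)"
proof -
  have c: "continuous_on ({0..\<tau>} \<times> {0..\<tau>}) (\<lambda>(x, y). h x y)"
    if "continuous_on ({0..T} \<times> {0..T}) (\<lambda>(x, y). h x y)" for h :: "real \<Rightarrow> real \<Rightarrow> real"
    by (rule continuous_on_subset[OF that]) (use assms in auto)
  note cs = c[OF contG] c[OF contH] c[OF contp] c[OF contq]
  have "integral {0..\<tau>} (\<lambda>y. G \<tau> y - G 0 y) + integral {0..\<tau>} (\<lambda>x. H x \<tau> - H x 0) =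
    integral {0..\<tau>} (\<lambda>x. integral {0..\<tau>} (\<lambda>y. (G x y * p x y - H x y * q x y) + (H x y * q x y - G x y * p x y)))"
    using assms cs
    by (intro green_square)
      (auto simp: split_beta intro!: continuous_intros
        has_field_derivative_subset[OF derivG] has_field_derivative_subset[OF derivH])
  then show ?thesis
    using assms
    by (simp add: outflow_def Henstock_Kurzweil_Integration.integral_diff integrable_slices)
qed

lemma outflow_diff:
  assumes "0 \<le> \<eta>" "\<eta> \<le> \<tau>" "\<tau> \<le> T"
  shows "outflow \<tau> - outflow \<eta> = integral {\<eta>..\<tau>} (G 0) + integral {\<eta>..\<tau>} (\<lambda>x. H x 0)"
proof -
  have "integral {0..\<eta>} (G 0) + integral {\<eta>..\<tau>} (G 0) = integral {0..\<tau>} (G 0)"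
    "integral {0..\<eta>} (\<lambda>x. H x 0) + integral {\<eta>..\<tau>} (\<lambda>x. H x 0) = integral {0..\<tau>} (\<lambda>x. H x 0)"
    using assms by (auto intro!: Henstock_Kurzweil_Integration.integral_combine integrable_slices)
  then show ?thesis
    by (simp add: outflow_def)
qed

lemma outflow_mono:
  assumes "0 \<le> \<eta>" "\<eta> \<le> \<tau>" "\<tau> \<le> T"
  shows "outflow \<eta> \<le> outflow \<tau>"
proof -
  have "0 \<le> integral {\<eta>..\<tau>} (G 0)" "0 \<le> integral {\<eta>..\<tau>} (\<lambda>x. H x 0)"
    using assms nonneg by (auto intro!: Henstock_Kurzweil_Integration.integral_nonneg integrable_slices)
  then show ?thesis
    using outflow_diff[OF assms] by simp
qed

text \<open>
  The weights \<open>exp (- 2 B x / (x + y))\<close> and \<open>exp (- 2 B y / (x + y))\<close> bound from below the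
  probability that a \<open>G\<close>- or an \<open>H\<close>-particle at \<open>(x, y)\<close> escapes, however the collisions are arranged:
  where a collision lowers the weight, the weight grows along the particle path at least
  at the relative rate \<open>B / (x + y)\<close>.
\<close>

lemma weighted_stream_antimono:
  assumes "0 < \<eta>" "\<eta> \<le> y" "y \<le> T" "0 \<le> B"
    and p: "\<And>x. 0 \<le> x \<Longrightarrow> x \<le> \<eta> \<Longrightarrow> p x y \<le> B / (x + y)"
  shows "exp (- 2 * B * \<eta> / (\<eta> + y)) * G \<eta> y \<le> G 0 y"
proof -
  let ?f = "\<lambda>x. exp (- 2 * B * x / (x + y)) * G x y"
  have "?f \<eta> \<le> ?f 0"
  proof (rule DERIV_nonpos_imp_decreasing_open[where f = ?f])
    fix x assume x: "0 < x" "x < \<eta>"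
    have "((\<lambda>x. G x y) has_real_derivative G x y * p x y - H x y * q x y) (at x)"
      using derivG[of x y] at_within_Icc_at[of 0 x T] x assms by auto
    then have "(?f has_real_derivative exp (- 2 * B * x / (x + y)) *
        (G x y * p x y - H x y * q x y - 2 * B * y / (x + y)^2 * G x y)) (at x)"
      using x assms
      by (auto intro!: derivative_eq_intros simp: power2_eq_square) (simp add: field_simps)
    \<comment> \<open>The right-hand side is the relative growth rate of the weight towards the
      axis. It dominates the collision rate because \<open>x < \<eta> \<le> y\<close> gives
      \<open>x + y \<le> 2 * y\<close>.\<close>
    moreover have "B / (x + y) \<le> 2 * B * y / (x + y)^2"
      using x assms mult_left_mono[of "x + y" "2 * y" B]
      by (simp add: divide_simps power2_eq_square mult_ac)
    then have "p x y * G x y \<le> 2 * B * y / (x + y)^2 * G x y"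
      using p[of x] x assms(1-4) nonneg[of x y] by (intro mult_right_mono) (linarith, auto)
    then have "G x y * p x y - H x y * q x y - 2 * B * y / (x + y)^2 * G x y \<le> 0"
    proof -
      have "0 \<le> H x y * q x y"
        using nonneg[of x y] x assms(1-3) by auto
      then show ?thesis
        using \<open>p x y * G x y \<le> _\<close> by (simp add: mult.commute[of "p x y"] del: times_divide_eq_left)
    qed
    ultimately show "\<exists>d. (?f has_real_derivative d) (at x) \<and> d \<le> 0"
      by (meson exp_ge_zero mult_nonneg_nonpos)
  next
    have "continuous_on {0..\<eta>} (\<lambda>x. G x y)"
      using assms by (intro continuous_on_slice2[OF contG]) auto
    then show "continuous_on {0..\<eta>} ?f"
      using assms by (auto intro!: continuous_intros)
  qed (use assms in auto)
  then show ?thesis by simp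
qed

text \<open>On the square away from the axes both streams must be weighted together, as particles
  change species. The divergence of the weighted flow turns out nonpositive, so the weighted mass
  reaching the near edges is at least the one entering at the far edges.\<close>

lemma weighted_green:
  assumes "0 < \<eta>" "\<eta> \<le> \<tau>" "\<tau> \<le> T" "0 \<le> B"
    and pq: "\<And>x y. x \<in> {\<eta>..\<tau>} \<Longrightarrow> y \<in> {\<eta>..\<tau>} \<Longrightarrow> p x y \<le> B / (x + y) \<and> q x y \<le> B / (x + y)"
  defines "V \<equiv> \<lambda>x y. exp (- 2 * B * x / (x + y))"
  shows "integral {\<eta>..\<tau>} (\<lambda>y. V \<tau> y * G \<tau> y - V \<eta> y * G \<eta> y) +
    integral {\<eta>..\<tau>} (\<lambda>x. V \<tau> x * H x \<tau> - V \<eta> x * H x \<eta>) \<le> 0"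
proof -
  let ?Q = "{\<eta>..\<tau>} \<times> {\<eta>..\<tau>}"
  define w where "w x y = G x y * p x y - H x y * q x y" for x y
  define f where "f x y = V x y * (w x y - 2 * B * y / (x + y)^2 * G x y)" for x y
  define g where "g x y = V y x * (- w x y - 2 * B * x / (x + y)^2 * H x y)" for x y
  have sub: "?Q \<subseteq> {0..T} \<times> {0..T}"
    using assms by auto
  have c: "continuous_on ?Q (\<lambda>z. h (fst z) (snd z))"
    if "continuous_on ({0..T} \<times> {0..T}) (\<lambda>(x, y). h x y)" for h :: "real \<Rightarrow> real \<Rightarrow> real"
    using continuous_on_subset[OF that sub] by (simp add: split_beta)
  note cs = c[OF contG] c[OF contH] c[OF contp] c[OF contq]
  have nz: "x + y \<noteq> 0" "y + x \<noteq> 0" if "(x, y) \<in> ?Q" for x y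
    using that assms by auto
  have cf: "continuous_on ?Q (\<lambda>(x, y). f x y)" and cg: "continuous_on ?Q (\<lambda>(x, y). g x y)"
    unfolding f_def g_def w_def V_def split_beta
    using nz by (auto intro!: continuous_intros cs)
  have dV: "((\<lambda>x. V x y) has_real_derivative V x y * (- 2 * B * y / (x + y)^2)) (at x within S)"
    if "x + y \<noteq> 0" for x y S
    using that unfolding V_def
    by (auto intro!: derivative_eq_intros simp: power2_eq_square) (simp add: field_simps)
  have "integral {\<eta>..\<tau>} (\<lambda>y. V \<tau> y * G \<tau> y - V \<eta> y * G \<eta> y) +
      integral {\<eta>..\<tau>} (\<lambda>x. V \<tau> x * H x \<tau> - V \<eta> x * H x \<eta>) =
    integral {\<eta>..\<tau>} (\<lambda>x. integral {\<eta>..\<tau>} (\<lambda>y. f x y + g x y))"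
  proof (rule green_square[where A = "\<lambda>x y. V x y * G x y" and C = "\<lambda>x y. V y x * H x y"])
    fix x y assume xy: "x \<in> {\<eta>..\<tau>}" "y \<in> {\<eta>..\<tau>}"
    then have n: "x + y \<noteq> 0" "y + x \<noteq> 0" and T: "x \<in> {0..T}" "y \<in> {0..T}"
      using assms by auto
    show "((\<lambda>x. V x y * G x y) has_real_derivative f x y) (at x within {\<eta>..\<tau>})"
      using DERIV_mult[OF dV[OF n(1)] has_field_derivative_subset[OF derivG[OF T], of "{\<eta>..\<tau>}"]] assms
      by (auto simp: f_def w_def algebra_simps)
    show "((\<lambda>y. V y x * H x y) has_real_derivative g x y) (at y within {\<eta>..\<tau>})"
      using DERIV_mult[OF dV[OF n(2)] has_field_derivative_subset[OF derivH[OF T], of "{\<eta>..\<tau>}"]] assms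
      by (auto simp: g_def w_def algebra_simps)
  qed (use assms cf cg in auto)
  also have "\<dots> \<le> integral {\<eta>..\<tau>} (\<lambda>x. 0)"
  proof (rule integral_le)
    have c2: "continuous_on ?Q (\<lambda>(x, y). f x y + g x y)"
      using continuous_on_add[OF cf cg] by (simp add: split_beta)
    show "(\<lambda>x. integral {\<eta>..\<tau>} (\<lambda>y. f x y + g x y)) integrable_on {\<eta>..\<tau>}"
      using integral_continuous_on_param[of "{\<eta>..\<tau>}" \<eta> \<tau> "\<lambda>x y. f x y + g x y"] c2
      by (intro integrable_continuous_real) (simp add: cbox_interval)
    fix x assume x: "x \<in> {\<eta>..\<tau>}"
    have "integral {\<eta>..\<tau>} (\<lambda>y. f x y + g x y) \<le> integral {\<eta>..\<tau>} (\<lambda>y. 0)"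
    proof (rule integral_le)
      show "(\<lambda>y. f x y + g x y) integrable_on {\<eta>..\<tau>}"
        using x by (intro integrable_continuous_real continuous_on_slice1[OF c2]) auto
      fix y assume y: "y \<in> {\<eta>..\<tau>}"
      have s: "0 < x + y" "0 < x" "0 < y" and T: "x \<in> {0..T}" "y \<in> {0..T}"
        using x y assms by auto
      note nn = nonneg[OF T] and b = pq[OF x y]
      have pos: "0 \<le> V x y" "0 \<le> V y x" by (auto simp: V_def)
      have mono: "V b a \<le> V a b" if "a \<le> b" "0 < a" for a b
      proof -
        have "a / (a + b) \<le> b / (b + a)"
          using that mult_mono[of a b a b] by (simp add: divide_simps algebra_simps)
        then show ?thesis
          using \<open>0 \<le> B\<close> mult_left_mono[of "a / (a + b)" "b / (b + a)" "2 * B"] by (simp add: V_def)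
      qed
      \<comment> \<open>For \<open>a \<le> b\<close> the first stream has the larger weight.
        Collisions into it have the favourable sign. Collisions out of it cost at most
        \<open>V a b * (g1 * r1)\<close>, which the growth of the weight absorbs since
        \<open>a + b \<le> 2 * b\<close>. The two sides of the diagonal use this with the roles of
        the streams exchanged.\<close>
      have key: "(V a b - V b a) * (g1 * r1 - g2 * r2) \<le> V a b * (2 * B * b / (a + b)^2 * g1)"
        if "0 < a" "a \<le> b" "0 \<le> g1" "0 \<le> g2" "0 \<le> r1" "0 \<le> r2" "r1 \<le> B / (a + b)"
        for a b g1 g2 r1 r2
      proof -
        have "(V a b - V b a) * (g1 * r1 - g2 * r2) \<le> (V a b - V b a) * (g1 * r1)"
          using mono that by (intro mult_left_mono) auto
        also have "\<dots> \<le> V a b * (g1 * r1)"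
          using that by (intro mult_right_mono) (auto simp: V_def)
        also have "\<dots> \<le> V a b * (2 * B * b / (a + b)^2 * g1)"
        proof (rule mult_left_mono)
          have "B / (a + b) \<le> 2 * B * b / (a + b)^2"
            using that assms mult_left_mono[of "a + b" "2 * b" B]
            by (simp add: divide_simps power2_eq_square mult_ac)
          then show "g1 * r1 \<le> 2 * B * b / (a + b)^2 * g1"
            using that by (subst mult.commute) (intro mult_right_mono, auto)
        qed (simp add: V_def)
        finally show ?thesis .
      qed
      have e: "f x y + g x y = (V x y - V y x) * w x y - V x y * (2 * B * y / (x + y)^2 * G x y)
          - V y x * (2 * B * x / (y + x)^2 * H x y)"
        by (simp add: f_def g_def add.commute algebra_simps)
      have r: "0 \<le> V x y * (2 * B * y / (x + y)^2 * G x y)"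
        "0 \<le> V y x * (2 * B * x / (y + x)^2 * H x y)"
        using pos s nn assms by auto
      show "f x y + g x y \<le> 0"
      proof (cases "x \<le> y")
        case True
        then show ?thesis
          using key[of x y "G x y" "H x y" "p x y" "q x y"] nn b s r unfolding e w_def by auto
      next
        case False
        then have "(V y x - V x y) * (H x y * q x y - G x y * p x y) \<le> V y x * (2 * B * x / (y + x)^2 * H x y)"
          using key[of y x "H x y" "G x y" "q x y" "p x y"] nn b s by (auto simp: add.commute)
        then show ?thesis
          using r unfolding e w_def by (auto simp: algebra_simps)
      qed
    qed (auto)
    then show "integral {\<eta>..\<tau>} (\<lambda>y. f x y + g x y) \<le> 0" by simp
  qed auto
  finally show ?thesis by simp
qed

text \<open>The mass is followed from the far edges to the edges at distance \<open>\<eta>\<close>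
  by \<open>weighted_green\<close>, then through the remaining strips to the axes by
  \<open>weighted_stream_antimono\<close>. It arrives on the axes beyond \<open>\<eta>\<close>,
  hence counts in the difference of the outflows.\<close>

lemma outflow_drop:
  assumes "0 < \<eta>" "\<eta> \<le> \<tau>" "\<tau> \<le> T" "0 \<le> B"
    and bd: "\<And>x y. x \<in> {0..\<tau>} \<Longrightarrow> y \<in> {0..\<tau>} \<Longrightarrow> \<eta> \<le> x + y \<Longrightarrow>
      G x y \<le> B / (x + y) \<and> H x y \<le> B / (x + y) \<and> p x y \<le> B / (x + y) \<and> q x y \<le> B / (x + y)"
  shows "exp (- 2 * B) * (outflow \<tau> - 2 * \<eta> * B / \<tau>) \<le> outflow \<tau> - outflow \<eta>"
proof -
  interpret sw: two_stream T "\<lambda>x y. H y x" "\<lambda>x y. G y x" "\<lambda>x y. q y x" "\<lambda>x y. p y x"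
    by (rule swap)
  define V where "V x y = exp (- 2 * B * x / (x + y))" for x y :: real
  have \<tau>: "\<tau> \<in> {0..T}" "\<eta> \<in> {0..T}" "0 < \<tau>" using assms by auto
  have I: "(\<lambda>y. V z y * G z y) integrable_on {\<eta>..\<tau>}" "(\<lambda>x. V z x * H x z) integrable_on {\<eta>..\<tau>}"
    if "z \<in> {\<eta>..\<tau>}" for z
    using that assms unfolding V_def
    by (auto intro!: integrable_continuous_real continuous_intros cont_slices)
  note IS = integrable_slices
  \<comment> \<open>The least escape weight with which a particle can enter.\<close>
  have low: "exp (- 2 * B) \<le> V \<tau> y" if "y \<in> {\<eta>..\<tau>}" for y
  proof -
    have "\<tau> / (\<tau> + y) \<le> 1"
      using that assms(1) \<tau> by simp
    then show ?thesis
      using \<open>0 \<le> B\<close> mult_left_mono[of "\<tau> / (\<tau> + y)" 1 "2 * B"] by (simp add: V_def)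
  qed
  \<comment> \<open>Mass entering within \<open>\<eta>\<close> of an axis is not followed; the two
    such edge pieces together give the correction \<open>2 * \<eta> * B / \<tau>\<close>.\<close>
  have small: "integral {0..\<eta>} h \<le> \<eta> * (B / \<tau>)"
    if "h integrable_on {0..\<eta>}" "\<And>y. y \<in> {0..\<eta>} \<Longrightarrow> h y \<le> B / (\<tau> + y)" for h
  proof -
    have "integral {0..\<eta>} h \<le> integral {0..\<eta>} (\<lambda>_. B / \<tau>)"
    proof (rule integral_le)
      fix y assume y: "y \<in> {0..\<eta>}"
      have "B / (\<tau> + y) \<le> B / \<tau>"
        using y assms \<tau> by (intro divide_left_mono) auto
      then show "h y \<le> B / \<tau>" using that(2)[OF y] by simp
    qed (use that in auto)
    then show ?thesis using assms by simp
  qed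
  have sG: "integral {0..\<eta>} (G \<tau>) \<le> \<eta> * (B / \<tau>)"
    using assms \<tau> bd[of \<tau>] by (intro small IS) auto
  have sH: "integral {0..\<eta>} (\<lambda>x. H x \<tau>) \<le> \<eta> * (B / \<tau>)"
    using assms \<tau> bd[of _ \<tau>] by (intro small IS) (auto simp: add.commute)
  have split: "integral {0..\<eta>} (G \<tau>) + integral {\<eta>..\<tau>} (G \<tau>) = integral {0..\<tau>} (G \<tau>)"
    "integral {0..\<eta>} (\<lambda>x. H x \<tau>) + integral {\<eta>..\<tau>} (\<lambda>x. H x \<tau>) = integral {0..\<tau>} (\<lambda>x. H x \<tau>)"
    using assms \<tau> by (auto intro!: Henstock_Kurzweil_Integration.integral_combine IS)
  have "exp (- 2 * B) * (outflow \<tau> - 2 * \<eta> * B / \<tau>) \<le>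
    exp (- 2 * B) * (integral {\<eta>..\<tau>} (G \<tau>) + integral {\<eta>..\<tau>} (\<lambda>x. H x \<tau>))"
    using sG sH split outflow_eq_inflow[of \<tau>] assms by (intro mult_left_mono) auto
  also have "\<dots> = integral {\<eta>..\<tau>} (\<lambda>y. exp (- 2 * B) * G \<tau> y) + integral {\<eta>..\<tau>} (\<lambda>x. exp (- 2 * B) * H x \<tau>)"
    by (simp add: distrib_left)
  also have "\<dots> \<le> integral {\<eta>..\<tau>} (\<lambda>y. V \<tau> y * G \<tau> y) + integral {\<eta>..\<tau>} (\<lambda>x. V \<tau> x * H x \<tau>)"
    using assms \<tau> low nonneg
    by (intro add_mono integral_le mult_right_mono I integrable_on_mult_right IS) auto
  also have "\<dots> \<le> integral {\<eta>..\<tau>} (\<lambda>y. V \<eta> y * G \<eta> y) + integral {\<eta>..\<tau>} (\<lambda>x. V \<eta> x * H x \<eta>)"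
  proof -
    have "integral {\<eta>..\<tau>} (\<lambda>y. V \<tau> y * G \<tau> y - V \<eta> y * G \<eta> y) +
        integral {\<eta>..\<tau>} (\<lambda>x. V \<tau> x * H x \<tau> - V \<eta> x * H x \<eta>) \<le> 0"
      unfolding V_def using assms bd by (intro weighted_green) auto
    then show ?thesis
      using assms by (simp add: Henstock_Kurzweil_Integration.integral_diff I)
  qed
  also have "\<dots> \<le> integral {\<eta>..\<tau>} (G 0) + integral {\<eta>..\<tau>} (\<lambda>x. H x 0)"
  proof (intro add_mono integral_le I IS)
    fix y assume y: "y \<in> {\<eta>..\<tau>}"
    show "V \<eta> y * G \<eta> y \<le> G 0 y"
      unfolding V_def using y assms bd[of _ y] by (intro weighted_stream_antimono) auto
    show "V \<eta> y * H y \<eta> \<le> H y 0"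
      unfolding V_def using y assms bd[of y] by (intro sw.weighted_stream_antimono) (auto simp: add.commute)
  qed (use assms in auto)
  also have "\<dots> = outflow \<tau> - outflow \<eta>"
    using assms by (simp add: outflow_diff)
  finally show ?thesis .
qed

end

section \<open>Discrete time scales and the divergent series\<close>

text \<open>At \<open>s = time_scale (Suc k)\<close> the critical rate has numerator
  \<open>ln \<bar>ln s\<bar> / 4 = ln (Suc k) / 2\<close>. With this as \<open>B\<close>, the factor
  \<open>exp (- 2 * B)\<close> is exactly \<open>1 / Suc k\<close>: here the constant 1/4 is matched
  to the harmonic series.\<close>

definition time_scale :: "nat \<Rightarrow> real" where
  "time_scale k = exp (- (real k)\<^sup>2)"

lemma time_scale_pos: "0 < time_scale k"
  by (simp add: time_scale_def)

lemma time_scale_antimono: "k \<le> l \<Longrightarrow> time_scale l \<le> time_scale k"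
  by (simp add: time_scale_def power_mono)

text \<open>The correction term of \<open>outflow_drop\<close> between consecutive scales. The ratio
  of the scales is \<open>exp (- (2 * k + 1))\<close>, which outweighs the logarithm.\<close>

lemma time_scale_ratio: "2 * time_scale (Suc k) * (ln (real (Suc k)) / 2) / time_scale k \<le> 1 / 4"
proof -
  have "time_scale (Suc k) / time_scale k = inverse (exp (2 * real k + 1))"
    by (simp only: exp_minus[symmetric]) (simp add: time_scale_def power2_eq_square algebra_simps flip: exp_diff)
  moreover have "4 * ln (real (Suc k)) \<le> exp (2 * real k + 1)"
  proof -
    have "ln (real (Suc k)) \<le> real k"
      using ln_le_minus_one[of "real (Suc k)"] by simp
    also have "4 * real k \<le> exp 1 * exp (2 * real k)"
      using mult_mono[of 2 "exp 1" "2 * real k" "exp (2 * real k)"]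
        exp_ge_add_one_self[of 1] exp_ge_add_one_self[of "2 * real k"] by auto
    finally show ?thesis
      by (simp add: exp_add mult.commute)
  qed
  moreover have "2 * time_scale (Suc k) * (ln (real (Suc k)) / 2) / time_scale k =
      ln (real (Suc k)) * (time_scale (Suc k) / time_scale k)"
    by simp
  ultimately show ?thesis
    by (simp only: inverse_eq_divide) (simp add: divide_simps)
qed

text \<open>If the outflow stayed above 1/2 down to scale \<open>K\<close>, every step would remove
  at least \<open>1 / (4 * Suc k)\<close>, and together more than the initial outflow.\<close>

lemma (in two_stream) outflow_le_half:
  assumes T: "T = time_scale k0" and "k0 \<le> K"
    and div: "ln (real (Suc k0)) < (\<Sum>k=k0..<K. 1 / (4 * real (Suc k)))"
    and bd: "\<And>k x y. k0 \<le> k \<Longrightarrow> x \<in> {0..T} \<Longrightarrow> y \<in> {0..T} \<Longrightarrow> time_scale (Suc k) \<le> x + y \<Longrightarrow>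
      max (max (G x y) (H x y)) (max (p x y) (q x y)) \<le> ln (real (Suc k)) / 2 / (x + y)"
  shows "outflow (time_scale K) \<le> 1 / 2"
proof (rule ccontr)
  assume "\<not> outflow (time_scale K) \<le> 1 / 2"
  then have big: "1 / 2 < outflow (time_scale k)" if "k0 \<le> k" "k \<le> K" for k
    using that outflow_mono[of "time_scale K" "time_scale k"] time_scale_antimono[of k K] time_scale_antimono[of k0 k]
      time_scale_pos[of K] T by auto
  have step: "1 / (4 * real (Suc k)) \<le> outflow (time_scale k) - outflow (time_scale (Suc k))"
    if "k0 \<le> k" "k < K" for k
  proof -
    let ?B = "ln (real (Suc k)) / 2"
    have "exp (- 2 * ?B) * (outflow (time_scale k) - 2 * time_scale (Suc k) * ?B / time_scale k)
        \<le> outflow (time_scale k) - outflow (time_scale (Suc k))"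
      using that T time_scale_antimono[of k0 k] time_scale_antimono[of k "Suc k"] time_scale_pos[of "Suc k"] bd[of k]
      by (intro outflow_drop) auto
    \<comment> \<open>Of the level 1/2, at most 1/4 is lost to the mass that is not
      followed.\<close>
    moreover have "1 / 4 \<le> outflow (time_scale k) - 2 * time_scale (Suc k) * ?B / time_scale k"
      using big[of k] time_scale_ratio[of k] that by simp
    then have "1 / real (Suc k) * (1 / 4) \<le> 1 / real (Suc k) * (outflow (time_scale k) - 2 * time_scale (Suc k) * ?B / time_scale k)"
      by (intro mult_left_mono) auto
    moreover have "exp (- 2 * ?B) = 1 / real (Suc k)"
      by (simp add: exp_minus inverse_eq_divide)
    ultimately show ?thesis
      by (simp add: mult.commute)
  qed
  have "(\<Sum>k=k0..<K. 1 / (4 * real (Suc k))) \<le> (\<Sum>k=k0..<K. outflow (time_scale k) - outflow (time_scale (Suc k)))"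
    using step by (intro sum_mono) auto
  also have "\<dots> = outflow (time_scale k0) - outflow (time_scale K)"
    using sum_Suc_diff'[OF \<open>k0 \<le> K\<close>, of "\<lambda>k. - outflow (time_scale k)"] by simp
  finally have "outflow (time_scale K) < outflow T - ln (real (Suc k0))"
    using div T by simp
  \<comment> \<open>Computed as inflow: on the far edges \<open>x + y \<ge> T\<close>, so the rate
    bound holds all along them, whereas the edges on the axes run into the corner.\<close>
  moreover have "outflow T \<le> ln (real (Suc k0))"
  proof -
    have le: "integral {0..T} h \<le> ln (real (Suc k0)) / 2"
      if "h integrable_on {0..T}" "\<And>y. y \<in> {0..T} \<Longrightarrow> h y \<le> ln (real (Suc k0)) / 2 / (T + y)" for h
    proof -
      have "integral {0..T} h \<le> integral {0..T} (\<lambda>_. ln (real (Suc k0)) / 2 / T)"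
      proof (rule integral_le)
        fix y assume y: "y \<in> {0..T}"
        have "ln (real (Suc k0)) / 2 / (T + y) \<le> ln (real (Suc k0)) / 2 / T"
          using y T time_scale_pos[of k0] by (intro divide_left_mono) auto
        then show "h y \<le> ln (real (Suc k0)) / 2 / T"
          using that(2)[OF y] by simp
      qed (use that in auto)
      then show ?thesis
        using T time_scale_pos[of k0] by simp
    qed
    have "0 < T" "time_scale (Suc k0) \<le> T"
      using T time_scale_pos time_scale_antimono[of k0 "Suc k0"] by auto
    then have bT: "G T y \<le> ln (real (Suc k0)) / 2 / (T + y)" "H y T \<le> ln (real (Suc k0)) / 2 / (T + y)"
      if "y \<in> {0..T}" for y
      using bd[of k0 T y] bd[of k0 y T] that by (auto simp: add.commute)
    have "integral {0..T} (G T) \<le> ln (real (Suc k0)) / 2"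
      using \<open>0 < T\<close> by (intro le bT integrable_slices) auto
    moreover have "integral {0..T} (\<lambda>x. H x T) \<le> ln (real (Suc k0)) / 2"
      using \<open>0 < T\<close> by (intro le bT integrable_slices) auto
    ultimately show ?thesis
      using outflow_eq_inflow[of T] \<open>0 < T\<close> by simp
  qed
  ultimately show False
    using big[of K] \<open>k0 \<le> K\<close> by simp
qed

lemma exists_harmonic_sum_gt:
  "\<exists>K\<ge>k0. C < (\<Sum>k=k0..<K. 1 / (4 * real (Suc k)))"
proof (rule ccontr)
  assume "\<not> ?thesis"
  then have le: "(\<Sum>k=k0..<K. 1 / (4 * real (Suc k))) \<le> C" if "k0 \<le> K" for K
    using that by (meson not_less)
  have "summable (\<lambda>k. 1 / (4 * real (Suc (k + k0))))"
  proof (rule bounded_imp_summable)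
    fix n
    have "(\<Sum>k\<le>n. 1 / (4 * real (Suc (k + k0)))) = (\<Sum>k=k0..<Suc n + k0. 1 / (4 * real (Suc k)))"
      using sum.shift_bounds_nat_ivl[of "\<lambda>k. 1 / (4 * real (Suc k))" 0 k0 "Suc n"]
      by (simp only: lessThan_Suc_atMost[symmetric] lessThan_atLeast0 add_0)
    also have "\<dots> \<le> C" by (rule le) simp
    finally show "(\<Sum>k\<le>n. 1 / (4 * real (Suc (k + k0)))) \<le> C" .
  qed simp
  moreover have "4 * (1 / (4 * real (Suc (k + k0)))) = inverse (real (k + Suc k0))" for k
    by (simp add: inverse_eq_divide divide_simps)
  ultimately have "summable (\<lambda>k. inverse (real (k + Suc k0)))"
    using summable_mult[of "\<lambda>k. 1 / (4 * real (Suc (k + k0)))" "4::real"] by (simp only:)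
  then show False
    using summable_iff_shift[of "\<lambda>k. inverse (real k)" "Suc k0"] not_summable_harmonic[where 'a=real] by simp
qed

section \<open>The Broadwell system in characteristic coordinates\<close>

lemma four_wrap: "(5::4) = 1" "(6::4) = 2" "(7::4) = 3"
  by simp_all

text \<open>With cyclic indices the four equations become one, so all pairs of neighbouring species
  are treated at once.\<close>

lemma collision_eq: "collision v i = v $ (i + 1) * v $ (i + 3) - v $ i * v $ (i + 2)"
  using exhaust_4[of i] by (auto simp: collision_def four_wrap mult.commute)

lemma norm_velocity: "norm (velocity i) = sqrt 2"
  by (auto simp: velocity_def norm_vec_def L2_set_def sum_2)

text \<open>Characteristic coordinates in the plane through \<open>P\<close> spanned by the directions of the
  neighbouring species \<open>i\<close> and \<open>i + 1\<close>; both run backwards in time.\<close>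

definition char_point :: "4 \<Rightarrow> real \<times> (real ^ 2) \<Rightarrow> real \<Rightarrow> real \<Rightarrow> real \<times> (real ^ 2)" where
  "char_point i P a b = (fst P - a - b, snd P - a *\<^sub>R velocity i - b *\<^sub>R velocity (i + 1))"

lemma norm_char_point:
  assumes "0 \<le> a" "0 \<le> b"
  shows "norm (snd (char_point i P a b) - snd P) \<le> sqrt 2 * (a + b)"
proof -
  have "norm (snd (char_point i P a b) - snd P) = norm (a *\<^sub>R velocity i + b *\<^sub>R velocity (i + 1))"
    by (simp add: char_point_def norm_minus_commute[of "snd P"] algebra_simps flip: norm_minus_cancel[of "_ - _"])
  also have "\<dots> \<le> sqrt 2 * (a + b)"
    using assms by (intro order.trans[OF norm_triangle_ineq]) (simp add: norm_velocity algebra_simps)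
  finally show ?thesis .
qed

text \<open>Varying \<open>a\<close> alone follows a characteristic of species \<open>i\<close>,
  varying \<open>b\<close> alone one of species \<open>i + 1\<close>. The collision partners
  \<open>p\<close> and \<open>q\<close> are the opposite species \<open>i + 2\<close> and
  \<open>i + 3\<close>. The condition on \<open>T\<close> keeps the square in
  \<open>t \<ge> 0\<close>, hence in the cone of dependence of \<open>P\<close>.\<close>

lemma broadwell_two_stream:
  assumes sol: "broadwell_solution D u" and P: "P \<in> D" and T: "2 * T \<le> fst P"
  shows "two_stream T (\<lambda>a b. u (char_point i P a b) $ i) (\<lambda>a b. u (char_point i P a b) $ (i + 1))
    (\<lambda>a b. u (char_point i P a b) $ (i + 2)) (\<lambda>a b. u (char_point i P a b) $ (i + 3))"
proof -
  have cont: "continuous_on D u" and nn: "\<And>p i. p \<in> D \<Longrightarrow> 0 \<le> u p $ i"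
    and cone: "\<And>t x s y. (t, x) \<in> D \<Longrightarrow> 0 \<le> s \<Longrightarrow> s \<le> t \<Longrightarrow> norm (y - x) \<le> sqrt 2 * (t - s) \<Longrightarrow> (s, y) \<in> D"
    and der: "\<And>t x i. (t, x) \<in> D \<Longrightarrow> ((\<lambda>s. u (s, x + (s - t) *\<^sub>R velocity i) $ i)
           has_real_derivative collision (u (t, x)) i) (at t within {0..})"
    using sol unfolding broadwell_solution_def max_speed_eq by auto
  have inD: "char_point i P a b \<in> D" if "a \<in> {0..T}" "b \<in> {0..T}" for a b
    using cone[of "fst P" "snd P" "fst (char_point i P a b)" "snd (char_point i P a b)"]
      norm_char_point[of a b i P] that P T
    by (auto simp: char_point_def)
  have cc: "continuous_on ({0..T} \<times> {0..T}) (\<lambda>(a, b). u (char_point i P a b) $ j)" for j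
  proof -
    have "continuous_on ({0..T} \<times> {0..T}) (\<lambda>z. char_point i P (fst z) (snd z))"
      unfolding char_point_def by (intro continuous_intros)
    then show ?thesis
      unfolding split_beta
      by (intro continuous_intros continuous_on_compose2[OF cont]) (use inD in auto)
  qed
  show ?thesis
  proof
    fix a b assume ab: "a \<in> {0..T}" "b \<in> {0..T}"
    let ?X = "char_point i P a b"
    have D: "(fst ?X, snd ?X) \<in> D" using inD[OF ab] by simp
    \<comment> \<open>Time decreases as the coordinate grows, which reverses the sign of the
      collision term.\<close>
    let ?g = "\<lambda>x. fst P - x - b"
    have "((\<lambda>s. u (s, snd ?X + (s - fst ?X) *\<^sub>R velocity i) $ i) \<circ> ?g has_real_derivative
        collision (u ?X) i * (-1)) (at a within {0..T})"
    proof (rule DERIV_image_chain)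
      show "((\<lambda>s. u (s, snd ?X + (s - fst ?X) *\<^sub>R velocity i) $ i) has_real_derivative
          collision (u ?X) i) (at (?g a) within ?g ` {0..T})"
        using der[OF D, of i] T ab
        by (auto simp: char_point_def intro: has_field_derivative_subset)
    qed (auto intro!: derivative_eq_intros)
    then show "((\<lambda>a. u (char_point i P a b) $ i) has_real_derivative
        u ?X $ i * u ?X $ (i + 2) - u ?X $ (i + 1) * u ?X $ (i + 3)) (at a within {0..T})"
      by (simp add: collision_eq char_point_def o_def algebra_simps)
    let ?h = "\<lambda>x. fst P - a - x"
    have "((\<lambda>s. u (s, snd ?X + (s - fst ?X) *\<^sub>R velocity (i + 1)) $ (i + 1)) \<circ> ?h has_real_derivative
        collision (u ?X) (i + 1) * (-1)) (at b within {0..T})"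
    proof (rule DERIV_image_chain)
      show "((\<lambda>s. u (s, snd ?X + (s - fst ?X) *\<^sub>R velocity (i + 1)) $ (i + 1)) has_real_derivative
          collision (u ?X) (i + 1)) (at (?h b) within ?h ` {0..T})"
        using der[OF D, of "i + 1"] T ab
        by (auto simp: char_point_def intro: has_field_derivative_subset)
    qed (auto intro!: derivative_eq_intros)
    moreover have wrap: "i + 1 + 1 = i + 2" "i + 1 + 2 = i + 3" "i + 1 + 3 = i"
      using exhaust_4[of i] by (auto simp: four_wrap)
    have "(\<lambda>s. u (s, snd ?X + (s - fst ?X) *\<^sub>R velocity (i + 1)) $ (i + 1)) \<circ> ?h =
        (\<lambda>b. u (char_point i P a b) $ (i + 1))"
      by (simp add: fun_eq_iff char_point_def algebra_simps)
    ultimately show "((\<lambda>b. u (char_point i P a b) $ (i + 1)) has_real_derivative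
        u ?X $ (i + 1) * u ?X $ (i + 3) - u ?X $ i * u ?X $ (i + 2)) (at b within {0..T})"
      by (simp only: collision_eq wrap) (simp add: mult.commute)
  qed (use cc nn inD in auto)
qed

text \<open>Along the \<open>H\<close>-characteristic on the axis the only gain is
  \<open>G * p\<close>, with \<open>p \<le> F\<close>, and the integral of \<open>G\<close> there is
  part of the outflow.\<close>

lemma (in two_stream) apex_le:
  assumes b: "0 \<le> b" "b \<le> T" and "0 \<le> F" and p: "\<And>y. y \<in> {0..b} \<Longrightarrow> p 0 y \<le> F"
  shows "H 0 0 \<le> H 0 b + F * outflow b"
proof -
  have sl: "continuous_on {0..b} (G 0)" "continuous_on {0..b} (H 0)"
    "continuous_on {0..b} (p 0)" "continuous_on {0..b} (q 0)"
    using b by (auto intro!: continuous_on_slice1[OF contG] continuous_on_slice1[OF contH]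
        continuous_on_slice1[OF contp] continuous_on_slice1[OF contq])
  have int: "((\<lambda>y. H 0 y * q 0 y - G 0 y * p 0 y) has_integral H 0 b - H 0 0) {0..b}"
    using b by (intro fundamental_theorem_of_calculus)
      (auto simp flip: has_real_derivative_iff_has_vector_derivative
        intro!: has_field_derivative_subset[OF derivH])
  have "- F * integral {0..b} (G 0) = integral {0..b} (\<lambda>y. - F * G 0 y)"
    by simp
  also have "\<dots> \<le> integral {0..b} (\<lambda>y. H 0 y * q 0 y - G 0 y * p 0 y)"
  proof (rule integral_le)
    show "(\<lambda>y. - F * G 0 y) integrable_on {0..b}"
      by (intro integrable_continuous_real continuous_intros sl)
    show "(\<lambda>y. H 0 y * q 0 y - G 0 y * p 0 y) integrable_on {0..b}"
      using int by blast
    fix y assume y: "y \<in> {0..b}"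
    have nn: "0 \<le> G 0 y" "0 \<le> H 0 y * q 0 y"
      using nonneg[of 0 y] y b by auto
    then show "- F * G 0 y \<le> H 0 y * q 0 y - G 0 y * p 0 y"
      using mult_left_mono[OF p[OF y] nn(1)] by (simp add: mult.commute)
  qed
  also have "\<dots> = H 0 b - H 0 0"
    using int by (rule integral_unique)
  finally have "H 0 0 \<le> H 0 b + F * integral {0..b} (G 0)"
    by simp
  moreover have "0 \<le> integral {0..b} (\<lambda>x. H x 0)"
    using b nonneg by (intro Henstock_Kurzweil_Integration.integral_nonneg integrable_slices) auto
  then have "F * integral {0..b} (G 0) \<le> F * outflow b"
    using \<open>0 \<le> F\<close> by (intro mult_left_mono) (simp_all add: outflow_def)
  ultimately show ?thesis by simp
qed

section \<open>Boundedness below the critical rate\<close>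

text \<open>Converts the rate at the true distance \<open>\<tau>\<close> to the blow-up time into
  the form required by \<open>outflow_le_half\<close>, where \<open>s\<close> is the smaller
  distance to the apex of a square. Numerator and denominator are compared separately.\<close>

lemma blowup_rate_le:
  assumes s: "time_scale (Suc k) \<le> s" "s \<le> \<tau>" and \<tau>: "\<tau> < 1 / 3"
  shows "ln (ln (1 / \<tau>)) / 4 / \<tau> \<le> ln (real (Suc k)) / 2 / s"
proof -
  have pos: "0 < s" "0 < \<tau>"
    using s time_scale_pos[of "Suc k"] by linarith+
  have "3 < 1 / \<tau>"
    using \<tau> pos by (simp add: field_simps)
  then have "exp 1 \<le> 1 / \<tau>"
    using exp_le by linarith
  then have l1: "1 \<le> ln (1 / \<tau>)"
    using pos by (simp add: ln_ge_iff)
  have "- (real (Suc k))\<^sup>2 \<le> ln \<tau>"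
    using s pos by (simp add: ln_ge_iff time_scale_def)
  then have "ln (1 / \<tau>) \<le> (real (Suc k))\<^sup>2"
    using pos by (simp add: ln_div)
  then have "ln (ln (1 / \<tau>)) \<le> ln ((real (Suc k))\<^sup>2)"
    using l1 by (intro ln_mono) auto
  also have "\<dots> = 2 * ln (real (Suc k))"
    by (simp add: ln_realpow)
  finally have "ln (ln (1 / \<tau>)) / 4 \<le> ln (real (Suc k)) / 2"
    by simp
  moreover have "0 \<le> ln (real (Suc k)) / 2"
    by simp
  ultimately show ?thesis
    using pos(1) s(2) by (blast intro: frac_le)
qed

text \<open>Let \<open>F\<close> be the supremum of all densities over a backward cone of
  \<open>P\<close> truncated at depth \<open>\<tau>\<close>. Outflow at most 1/2 gives
  \<open>F \<le> c + F / 2\<close>, hence \<open>F \<le> 2 * c\<close>, where \<open>c\<close> does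
  not depend on \<open>P\<close>.\<close>

lemma bounded_of_blowup_rate_bound:
  assumes sol: "broadwell_solution D u" and "0 < ts" "0 < d" "d \<le> 1 / 3"
    and rate: "\<And>t x i. (t, x) \<in> D \<Longrightarrow> t < ts \<Longrightarrow> dist (t, x) (ts, xs) < d \<Longrightarrow>
      u (t, x) $ i \<le> ln (ln (1 / (ts - t))) / 4 / (ts - t)"
  shows "\<exists>\<rho>>0. \<exists>C. \<forall>P\<in>D. fst P < ts \<longrightarrow> dist P (ts, xs) < \<rho> \<longrightarrow> (\<forall>i. u P $ i \<le> C)"
proof -
  have cont: "continuous_on D u" and nn: "\<And>p i. p \<in> D \<Longrightarrow> 0 \<le> u p $ i"
    and cone: "\<And>t x s y. (t, x) \<in> D \<Longrightarrow> 0 \<le> s \<Longrightarrow> s \<le> t \<Longrightarrow> norm (y - x) \<le> sqrt 2 * (t - s) \<Longrightarrow> (s, y) \<in> D"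
    using sol unfolding broadwell_solution_def max_speed_eq by auto
  \<comment> \<open>With \<open>T = time_scale k0\<close>, points of the cone of depth
    \<open>3 * T\<close> are within \<open>9 * T\<close> of \<open>P\<close>, and \<open>P\<close>
    is within \<open>T\<close> of the blow-up point, hence the 10. The 4 ensures that this cone
    stays in positive time.\<close>
  obtain k0 where k0: "10 * time_scale k0 < d" "4 * time_scale k0 < ts"
  proof -
    define e where "e = min (d / 10) (ts / 4)"
    have "0 < e" using assms by (simp add: e_def)
    obtain n :: nat where "- ln e < real n"
      using reals_Archimedean2 by blast
    then obtain k where k: "- ln e < real k" "1 \<le> k"
      by (intro that[of "Suc n"]) auto
    have "real k \<le> (real k)\<^sup>2"
      by (rule self_le_power) (use k(2) in auto)
    then have "- (real k)\<^sup>2 < ln e"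
      using k(1) by linarith
    then have "exp (- (real k)\<^sup>2) < exp (ln e)"
      by (simp only: exp_less_cancel_iff)
    then have "time_scale k < e"
      using \<open>0 < e\<close> by (simp add: time_scale_def)
    then show ?thesis
      by (intro that[of k]) (auto simp: e_def)
  qed
  define T where "T = time_scale k0"
  obtain K where K: "k0 \<le> K" "ln (real (Suc k0)) < (\<Sum>k=k0..<K. 1 / (4 * real (Suc k)))"
    using exists_harmonic_sum_gt by blast
  define \<tau> where "\<tau> = time_scale K"
  have T: "0 < T" "0 < \<tau>" "\<tau> \<le> T"
    using K time_scale_pos time_scale_antimono by (auto simp: T_def \<tau>_def)
  define c where "c = ln (real (Suc K)) / 2 / \<tau>"
  have "u P $ j \<le> 2 * c" if P: "P \<in> D" "fst P < ts" "dist P (ts, xs) < T" for P j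
  proof -
    \<comment> \<open>The backward cone of dependence of \<open>P\<close>, cut off at depth
      \<open>r\<close> in time.\<close>
    define Z where "Z r = {X. fst P - r \<le> fst X \<and> fst X \<le> fst P \<and>
      norm (snd X - snd P) \<le> sqrt 2 * (fst P - fst X)}" for r
    have "dist (fst P) ts < T"
      using P(3) dist_fst_le[of P "(ts, xs)"] by simp
    then have Pt: "3 * T < fst P"
      using k0 by (simp add: dist_real_def T_def)
    have near: "X \<in> D \<and> fst X < ts \<and> dist X (ts, xs) < d" if "X \<in> Z (3 * T)" for X
    proof (intro conjI)
      show "X \<in> D"
        using cone[of "fst P" "snd P" "fst X" "snd X"] that P Pt by (simp add: Z_def)
      show "fst X < ts"
        using that P by (simp add: Z_def)
      have "sqrt 2 \<le> 2"
        by (rule real_le_lsqrt) auto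
      then have "sqrt 2 * (fst P - fst X) \<le> 2 * (3 * T)"
        using that T by (intro mult_mono) (auto simp: Z_def)
      then have "norm (snd (X - P)) \<le> 6 * T" "norm (fst (X - P)) \<le> 3 * T"
        using that by (auto simp: Z_def)
      then have "dist X P \<le> 9 * T"
        using norm_Pair_le[of "fst (X - P)" "snd (X - P)"] unfolding dist_norm prod.collapse by linarith
      then show "dist X (ts, xs) < d"
        using P(3) k0 dist_triangle[of X "(ts, xs)" P] by (simp add: T_def)
    qed
    have rate': "u X $ i \<le> ln (real (Suc k)) / 2 / s"
      if "X \<in> Z (3 * T)" "time_scale (Suc k) \<le> s" "s \<le> ts - fst X" for X i k s
    proof -
      have "dist (fst X) ts < 1 / 3"
        using near[OF that(1)] \<open>d \<le> 1 / 3\<close> dist_fst_le[of X "(ts, xs)"] by simp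
      then have "ts - fst X < 1 / 3"
        unfolding dist_real_def by linarith
      then show ?thesis
        using rate[of "fst X" "snd X" i] near[OF that(1)] blowup_rate_le[OF that(2,3)] by simp
    qed
    have ZZ: "char_point i Q a b \<in> Z (r + a + b)"
      if "Q \<in> Z r" "0 \<le> a" "0 \<le> b" for i Q a b r
    proof -
      have "norm (snd (char_point i Q a b) - snd P) \<le>
          norm (snd (char_point i Q a b) - snd Q) + norm (snd Q - snd P)"
        using norm_triangle_ineq[of "snd (char_point i Q a b) - snd Q" "snd Q - snd P"] by simp
      also have "\<dots> \<le> sqrt 2 * (a + b) + sqrt 2 * (fst P - fst Q)"
        using that norm_char_point[of a b i Q] by (intro add_mono) (auto simp: Z_def)
      also have "\<dots> = sqrt 2 * (fst P - fst (char_point i Q a b))"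
        by (simp add: char_point_def algebra_simps)
      finally show ?thesis
        using that by (simp add: Z_def) (simp add: char_point_def)
    qed
    have Zmono: "Z r \<subseteq> Z r'" if "r \<le> r'" for r r'
      using that by (auto simp: Z_def)
    define S where "S = (\<Union>Q\<in>Z \<tau>. range (\<lambda>i. u Q $ i))"
    have inS: "u Q $ i \<in> S" if "Q \<in> Z \<tau>" for Q i
      using that by (auto simp: S_def)
    have PZ: "P \<in> Z \<tau>"
      using T by (simp add: Z_def)
    have bdd: "bdd_above S"
    proof -
      have "closed (Z \<tau>)"
        unfolding Z_def by (intro closed_Collect_conj closed_Collect_le continuous_intros)
      moreover have "Z \<tau> \<subseteq> cball (ts, xs) d"
        using near Zmono[of \<tau> "3 * T"] T by (auto simp: dist_commute less_imp_le subset_iff)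
      then have "bounded (Z \<tau>)"
        by (rule bounded_subset[OF bounded_cball])
      ultimately have "compact (Z \<tau>)"
        by (simp add: compact_eq_bounded_closed)
      moreover have "Z \<tau> \<subseteq> D"
        using near Zmono[of \<tau> "3 * T"] T by auto
      ultimately have "bounded (u ` Z \<tau>)"
        by (intro compact_imp_bounded compact_continuous_image continuous_on_subset[OF cont])
      then obtain M where M: "\<And>Q. Q \<in> Z \<tau> \<Longrightarrow> norm (u Q) \<le> M"
        by (auto simp: bounded_iff)
      show ?thesis
      proof (rule bdd_aboveI)
        fix v assume "v \<in> S"
        then obtain Q i where "Q \<in> Z \<tau>" "v = u Q $ i" by (auto simp: S_def)
        then show "v \<le> M"
          using M[of Q] component_le_norm_cart[of "u Q" i] by simp
      qed
    qed
    \<comment> \<open>Finite by compactness of \<open>Z \<tau>\<close>, which is what allows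
      \<open>F / 2\<close> to be absorbed at the end.\<close>
    define F where "F = Sup S"
    have leF: "u Q $ i \<le> F" if "Q \<in> Z \<tau>" for Q i
      using cSup_upper[OF inS[OF that] bdd] by (simp add: F_def)
    have "0 \<le> F"
      using leF[OF PZ] nn[OF P(1)] by (meson order.trans)
    have step: "u Q $ (i + 1) \<le> c + F / 2" if Q: "Q \<in> Z \<tau>" for Q i
    proof -
      \<comment> \<open>Depth \<open>\<tau>\<close> to reach \<open>Q\<close> and at most
        \<open>2 * T\<close> for the square below it.\<close>
      have Q3: "char_point i Q a b \<in> Z (3 * T)" if "a \<in> {0..T}" "b \<in> {0..T}" for a b
        using ZZ[OF Q, of a b i] that T Zmono[of "\<tau> + a + b" "3 * T"] by auto
      have "Q \<in> D" "fst Q \<le> fst P" "fst P - \<tau> \<le> fst Q"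
        using Q near Zmono[of \<tau> "3 * T"] T by (auto simp: Z_def)
      then interpret two_stream T "\<lambda>a b. u (char_point i Q a b) $ i" "\<lambda>a b. u (char_point i Q a b) $ (i + 1)"
        "\<lambda>a b. u (char_point i Q a b) $ (i + 2)" "\<lambda>a b. u (char_point i Q a b) $ (i + 3)"
        using T Pt by (intro broadwell_two_stream[OF sol]) auto
      have small: "outflow \<tau> \<le> 1 / 2"
        unfolding \<tau>_def
      proof (rule outflow_le_half[OF T_def K])
        fix k a b assume "a \<in> {0..T}" "b \<in> {0..T}" "time_scale (Suc k) \<le> a + b"
        then have "u (char_point i Q a b) $ j \<le> ln (real (Suc k)) / 2 / (a + b)" for j
          using Q3[of a b] P \<open>fst Q \<le> fst P\<close> by (intro rate') (auto simp: char_point_def)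
        then show "max (max (u (char_point i Q a b) $ i) (u (char_point i Q a b) $ (i + 1)))
            (max (u (char_point i Q a b) $ (i + 2)) (u (char_point i Q a b) $ (i + 3)))
          \<le> ln (real (Suc k)) / 2 / (a + b)"
          by (simp only: max.bounded_iff simp_thms)
      qed
      \<comment> \<open>The characteristic from \<open>Q\<close> is followed down to the bottom of
        \<open>Z \<tau>\<close>. There the time left before \<open>ts\<close> exceeds
        \<open>\<tau>\<close>, so the rate bounds the density by \<open>c\<close>.\<close>
      define b where "b = fst Q - (fst P - \<tau>)"
      have b: "0 \<le> b" "b \<le> \<tau>"
        using \<open>fst Q \<le> fst P\<close> \<open>fst P - \<tau> \<le> fst Q\<close> by (auto simp: b_def)
      have "u (char_point i Q 0 0) $ (i + 1) \<le> u (char_point i Q 0 b) $ (i + 1) + F * outflow b"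
      proof (rule apex_le)
        fix y assume y: "y \<in> {0..b}"
        then have "char_point i Q 0 y \<in> Z \<tau>"
          using ZZ[OF Q, of 0 y i] by (auto simp: Z_def char_point_def b_def)
        then show "u (char_point i Q 0 y) $ (i + 2) \<le> F" by (rule leF)
      qed (use b T \<open>0 \<le> F\<close> in auto)
      moreover have "outflow b \<le> 1 / 2"
        using outflow_mono[of b \<tau>] b T small by simp
      then have "F * outflow b \<le> F * (1 / 2)"
        using \<open>0 \<le> F\<close> by (intro mult_left_mono)
      moreover have "u (char_point i Q 0 b) $ (i + 1) \<le> c"
        unfolding c_def using Q3[of 0 b] b T P time_scale_antimono[of K "Suc K"]
        by (intro rate') (auto simp: char_point_def b_def \<tau>_def)
      ultimately show ?thesis
        by (simp add: char_point_def)
    qed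
    have "F \<le> c + F / 2"
      unfolding F_def
    proof (rule cSup_least)
      show "S \<noteq> {}" using inS[OF PZ] by auto
      fix v assume "v \<in> S"
      then obtain Q j where Q: "Q \<in> Z \<tau>" "v = u Q $ j" by (auto simp: S_def)
      \<comment> \<open>\<open>step\<close> bounds the second species of a pair, so \<open>j\<close>
        is paired with its cyclic predecessor \<open>j + 3\<close>.\<close>
      have "j + 3 + 1 = j"
        using exhaust_4[of j] by (auto simp: four_wrap)
      then show "v \<le> c + Sup S / 2"
        using step[OF Q(1), of "j + 3"] Q(2) by (simp only: F_def)
    qed
    then show ?thesis
      using leF[OF PZ, of j] by simp
  qed
  then show ?thesis
    using T(1) by blast
qed

section \<open>Contradiction at the blow-up point\<close>

theorem corollary5p1:
  fixes D :: "(real \<times> (real ^ 2)) set"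
    and u :: "real \<times> (real ^ 2) \<Rightarrow> real ^ 4"
    and ts :: real and xs :: "real ^ 2"
  assumes "broadwell_solution D u"
    and "primary_blowup_point D u ts xs"
  shows "Limsup (before_point D ts xs)
           (\<lambda>(t, x). ereal (norm (u (t, x)) * ((ts - t) / ln \<bar>ln (ts - t)\<bar>))) \<ge> ereal (1 / 4)"
proof (rule ccontr)
  assume "\<not> ?thesis"
  then have "eventually (\<lambda>p. (\<lambda>(t, x). ereal (norm (u (t, x)) * ((ts - t) / ln \<bar>ln (ts - t)\<bar>))) p < ereal (1 / 4))
      (before_point D ts xs)"
    by (intro Limsup_lessD) (simp add: not_le)
  then obtain e where "0 < e" and e: "\<And>t x. (t, x) \<in> D \<Longrightarrow> t < ts \<Longrightarrow> dist (t, x) (ts, xs) < e \<Longrightarrow>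
      norm (u (t, x)) * ((ts - t) / ln \<bar>ln (ts - t)\<bar>) < 1 / 4"
    unfolding before_point_def eventually_at by auto
  have "blowup_point D u ts xs"
    using assms(2) unfolding primary_blowup_point_def by (rule conjunct1)
  then obtain i where i: "Limsup (before_point D ts xs) (\<lambda>p. ereal (u p $ i)) = \<infinity>"
    unfolding blowup_point_def by (rule exE)
  \<comment> \<open>Otherwise no point of \<open>D\<close> precedes \<open>ts\<close>, the filter is
    trivial, and the \<open>Limsup\<close> is minus infinity.\<close>
  have "0 < ts"
  proof (rule ccontr)
    assume "\<not> 0 < ts"
    have "D \<subseteq> {0..} \<times> UNIV"
      using assms(1) unfolding broadwell_solution_def by (intro openin_imp_subset) (rule conjunct1)
    then have "0 \<le> t" if "(t, x) \<in> D" for t x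
      using that by auto
    with \<open>\<not> 0 < ts\<close> have "{(t, x). (t, x) \<in> D \<and> t < ts} = {}"
      by force
    then have "before_point D ts xs = bot"
      unfolding before_point_def by (simp only: at_within_empty)
    then show False
      using i by (simp add: Limsup_bot bot_ereal_def)
  qed
  \<comment> \<open>As 1/3 lies below \<open>exp (- 1)\<close>, the iterated logarithm is positive
    at distances below \<open>d\<close>, so the assumed inequality can be multiplied out.\<close>
  define d where "d = min e (1 / 3)"
  have d: "0 < d" "d \<le> 1 / 3"
    using \<open>0 < e\<close> by (simp_all add: d_def)
  have rate: "u (t, x) $ i \<le> ln (ln (1 / (ts - t))) / 4 / (ts - t)"
    if tx: "(t, x) \<in> D" "t < ts" "dist (t, x) (ts, xs) < d" for t x i
  proof -
    define \<tau> where "\<tau> = ts - t"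
    have "dist t ts < 1 / 3"
      using tx(3) dist_fst_le[of "(t, x)" "(ts, xs)"] by (simp add: d_def)
    then have \<tau>: "0 < \<tau>" "\<tau> < 1 / 3"
      using tx(2) unfolding dist_real_def \<tau>_def by linarith+
    have "3 < 1 / \<tau>"
      using \<tau> by (simp add: field_simps)
    then have "exp 1 < 1 / \<tau>"
      using exp_le by linarith
    then have "1 < ln (1 / \<tau>)"
      using \<tau> ln_less_cancel_iff[of "exp 1" "1 / \<tau>"] by simp
    moreover have "\<bar>ln \<tau>\<bar> = ln (1 / \<tau>)"
      using \<tau> calculation by (simp add: ln_div)
    ultimately have "0 < ln (ln (1 / \<tau>))" "norm (u (t, x)) * (\<tau> / ln (ln (1 / \<tau>))) < 1 / 4"
      using e[OF tx(1,2)] tx(3) by (auto simp: d_def \<tau>_def)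
    then have "norm (u (t, x)) \<le> ln (ln (1 / \<tau>)) / 4 / \<tau>"
      using \<tau> by (simp add: field_simps)
    then show ?thesis
      using component_le_norm_cart[of "u (t, x)" i] by (simp add: \<tau>_def)
  qed
  obtain \<rho> C where "0 < \<rho>" and C: "\<And>P i. P \<in> D \<Longrightarrow> fst P < ts \<Longrightarrow> dist P (ts, xs) < \<rho> \<Longrightarrow> u P $ i \<le> C"
    using bounded_of_blowup_rate_bound[OF assms(1) \<open>0 < ts\<close> d rate] by blast
  have "Limsup (before_point D ts xs) (\<lambda>p. ereal (u p $ i)) \<le> ereal C"
    unfolding before_point_def
    by (rule Limsup_bounded) (use \<open>0 < \<rho>\<close> C in \<open>force simp: eventually_at\<close>)
  then show False
    using i by simp
qed

end
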